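(* Let $f:\mathbf{R}^2\to\mathbf{R}$, $(\lambda,r)\mapsto f(\lambda,r)$, satisfy the condition of period doubling bifurcation at a point $(\lambda_0,r_0)\in\mathbf{R}^2$. Let $g:\mathbf{R}^2\to\mathbf{R}$, $(\lambda,r)\mapsto g(\lambda,r)$, be continuous with respect to $r$, and suppose that for every $\lambda$ and all 2-periodic points $r_1,r_2$ of $f(\lambda,\cdot)$ (that is, $r_1\neq r_2$, $f(\lambda,r_1)=r_2$, $f(\lambda,r_2)=r_1$) the numbers $g(\lambda,r_1)$ and $g(\lambda,r_2)$ are irrational. Define $\Theta_\lambda:\mathbf{R}\times S^1\to S^1$ by $\Theta_\lambda(r,[\theta])=[\theta]+[g(\lambda,r)]$ and $F_\lambda:\mathbf{R}\times S^1\to\mathbf{R}\times S^1$ by $F_\lambda(r,[\theta])=(f(\lambda,r),\Theta_\lambda(r,[\theta]))$. Then there exists $\lambda_1\in\mathbf{R}$, $\lambda_1\neq\lambda_0$, such that for each $\lambda\in(\lambda_0,\lambda_1)$ (if $\lambda_0<\lambda_1$), respectively each $\lambda\in(\lambda_1,\lambda_0)$ (if $\lambda_1<\lambda_0$), there exist circles $\Gamma_\lambda^1,\Gamma_\lambda^2\subset\mathbf{R}\times S^1$, invariant with respect to $F_\lambda^2$, such that: (1) $\Gamma_\lambda^1\cap\Gamma_\lambda^2=\emptyset$, $F_\lambda^2(\Gamma_\lambda^1)=\Gamma_\lambda^1$ and $F_\lambda^2(\Gamma_\lambda^2)=\Gamma_\lambda^2$; (2) $F_\lambda(\Gamma_\lambda^1)=\Gamma_\lambda^2$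 and $F_\lambda(\Gamma_\lambda^2)=\Gamma_\lambda^1$; (3) $F_\lambda(\Gamma_\lambda^1\cup\Gamma_\lambda^2)=\Gamma_\lambda^1\cup\Gamma_\lambda^2$.
   Context: $S^1$ is identified with the additive group $\mathbf{R}/\mathbf{Z}$, and $[\theta]$ denotes the class of $\theta\in\mathbf{R}$. $F_\lambda^2=F_\lambda\circ F_\lambda$. A circle is a subset of $\mathbf{R}\times S^1$ homeomorphic to $S^1$ (with the subspace topology); it is invariant with respect to $F_\lambda^2$ if $F_\lambda^2(\Gamma)=\Gamma$. The condition of period doubling (flip) bifurcation at $(\lambda_0,r_0)$ is the standard one: $f$ is of class $C^3$ in a neighborhood of $(\lambda_0,r_0)$ and, with all partial derivatives evaluated at $(\lambda_0,r_0)$, $$f(\lambda_0,r_0)=r_0,\qquad \frac{\partial f}{\partial r}=-1,$$ $$\frac{\partial^2 f}{\partial\lambda\,\partial r}+\frac12\,\frac{\partial f}{\partial\lambda}\,\frac{\partial^2 f}{\partial r^2}\neq0,\qquad \frac12\left(\frac{\partial^2 f}{\partial r^2}\right)^2+\frac13\,\frac{\partial^3 f}{\partial r^3}\neq0.$$ *)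

theory Defs
  imports "HOL-Analysis.Analysis"
begin

definition int_cong :: "real \<Rightarrow> real \<Rightarrow> bool"
  where "int_cong x y \<longleftrightarrow> x - y \<in> \<int>"

lemma equivp_int_cong: "equivp int_cong"
proof (rule equivpI)
  show "reflp int_cong"
    by (simp add: reflp_def int_cong_def)
  show "symp int_cong"
    unfolding symp_def int_cong_def by (metis Ints_minus minus_diff_eq)
  show "transp int_cong"
    unfolding transp_def int_cong_def by (metis Ints_add add_diff_eq diff_add_cancel)
qed

quotient_type S1 = real / int_cong
  by (rule equivp_int_cong)

lift_definition S1_class :: "real \<Rightarrow> S1" is "\<lambda>x. x" .

lemma S1_class_eq_iff: "S1_class x = S1_class y \<longleftrightarrow> x - y \<in> \<int>"
  by transfer (simp add: int_cong_def)

lemma S1_class_surj: "surj S1_class"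
proof -
  have "\<exists>x. t = S1_class x" for t
    by transfer (metis equivp_int_cong equivp_reflp)
  then show ?thesis by (auto simp: surj_def)
qed

instantiation S1 :: ab_group_add
begin

lift_definition zero_S1 :: S1 is 0 .

lift_definition plus_S1 :: "S1 \<Rightarrow> S1 \<Rightarrow> S1" is "(+)"
  unfolding int_cong_def by (metis Ints_add add_diff_add)

lift_definition uminus_S1 :: "S1 \<Rightarrow> S1" is uminus
  unfolding int_cong_def by (metis Ints_minus minus_diff_minus)

lift_definition minus_S1 :: "S1 \<Rightarrow> S1 \<Rightarrow> S1" is "(-)"
  unfolding int_cong_def by (metis Ints_diff diff_diff_eq diff_diff_eq2 diff_add_eq add_diff_eq add.commute)

instance
  by standard (transfer; simp add: int_cong_def)+

end

lemma S1_class_add: "S1_class (x + y) = S1_class x + S1_class y"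
  by transfer (simp add: int_cong_def)

text \<open>The topology is the quotient topology of the projection from the real line.\<close>

instantiation S1 :: topological_space
begin

definition open_S1 :: "S1 set \<Rightarrow> bool"
  where "open_S1 U \<longleftrightarrow> open (S1_class -` U)"

instance
proof
  show "open (UNIV :: S1 set)"
    by (simp add: open_S1_def)
  show "open (S \<inter> T)" if "open S" "open T" for S T :: "S1 set"
    using that by (simp add: open_S1_def vimage_Int open_Int)
  show "open (\<Union>K)" if "\<forall>S\<in>K. open S" for K :: "S1 set set"
    using that by (auto simp: open_S1_def vimage_Union)
qed

end

lemma continuous_on_S1_class: "continuous_on A S1_class"
proof -
  have "continuous_on UNIV S1_class"
    by (simp add: continuous_on_open_vimage open_S1_def)
  then show ?thesis
    by (rule continuous_on_subset) simp
qed

text \<open>The quotient is the usual circle, via the map sending the class of x to exp (2 pi i x).\<close>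

lemma S1_homeomorphic_unit_circle: "(UNIV :: S1 set) homeomorphic sphere (0::complex) 1"
proof -
  have cis_eq: "cis (2 * pi * x) = cis (2 * pi * y) \<longleftrightarrow> x - y \<in> \<int>" for x y :: real
  proof -
    have "cis (2 * pi * x) = cis (2 * pi * y) \<longleftrightarrow> cis (2 * pi * (x - y)) = 1"
      by (simp add: right_diff_distrib flip: cis_divide)
    also have "\<dots> \<longleftrightarrow> (\<exists>n::int. 2 * pi * (x - y) = of_int n * (2 * pi))"
      by (auto simp: complex_eq_iff cos_one_2pi_int)
    also have "\<dots> \<longleftrightarrow> x - y \<in> \<int>"
      by (auto elim!: Ints_cases)
    finally show ?thesis .
  qed
  define e :: "S1 \<Rightarrow> complex" where "e t = cis (2 * pi * (SOME x. S1_class x = t))" for t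
  have e: "e (S1_class x) = cis (2 * pi * x)" for x
  proof -
    have "S1_class (SOME y. S1_class y = S1_class x) = S1_class x"
      by (rule someI) (rule refl)
    then show ?thesis
      by (simp add: e_def cis_eq S1_class_eq_iff)
  qed
  have "compact (S1_class ` {0..1})"
    by (intro compact_continuous_image continuous_on_S1_class compact_Icc)
  moreover have "S1_class ` {0..1} = UNIV"
  proof -
    have "S1_class x \<in> S1_class ` {0..1}" for x
    proof (rule image_eqI)
      show "S1_class x = S1_class (frac x)"
        by (simp add: S1_class_eq_iff frac_def)
      show "frac x \<in> {0..1}"
        by (simp add: frac_ge_0 less_imp_le frac_lt_1)
    qed
    then show ?thesis using S1_class_surj by (metis UNIV_eq_I surj_def)
  qed
  ultimately have comp: "compact (UNIV :: S1 set)" by simp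
  have cont: "continuous_on UNIV e"
  proof -
    have "open (e -` B)" if "open B" for B
    proof -
      have "S1_class -` (e -` B) = (\<lambda>x. cis (2 * pi * x)) -` B"
        by (auto simp: e)
      moreover have "open ((\<lambda>x. cis (2 * pi * x)) -` B)"
        by (intro open_vimage that continuous_intros)
      ultimately show ?thesis by (simp add: open_S1_def)
    qed
    then show ?thesis by (simp add: continuous_on_open_vimage)
  qed
  have inj: "inj e"
  proof (rule injI)
    fix s t assume st: "e s = e t"
    obtain x y where "s = S1_class x" "t = S1_class y"
      using S1_class_surj by (metis surj_def)
    then show "s = t" using st by (simp add: e cis_eq S1_class_eq_iff)
  qed
  have img: "range e = sphere 0 1"
  proof
    show "range e \<subseteq> sphere 0 1" by (auto simp: e_def)
    show "sphere 0 1 \<subseteq> range e"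
    proof
      fix z :: complex assume "z \<in> sphere 0 1"
      then have "norm z = 1" by simp
      then have "z \<noteq> 0" by auto
      then have "z = cis (Arg z)" using cis_Arg[of z] \<open>norm z = 1\<close> by (simp add: sgn_eq)
      then have "z = e (S1_class (Arg z / (2 * pi)))" by (simp add: e)
      then show "z \<in> range e" by blast
    qed
  qed
  show ?thesis
    by (rule homeomorphic_compact[OF comp cont img inj])
qed

definition pd1 :: "(real \<times> real \<Rightarrow> real) \<Rightarrow> real \<times> real \<Rightarrow> real"
  where "pd1 f = (\<lambda>(l, r). deriv (\<lambda>x. f (x, r)) l)"

definition pd2 :: "(real \<times> real \<Rightarrow> real) \<Rightarrow> real \<times> real \<Rightarrow> real"
  where "pd2 f = (\<lambda>(l, r). deriv (\<lambda>x. f (l, x)) r)"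

text \<open>To be used for open sets U. As \<^const>\<open>deriv\<close> is total, the existence of the
  partial derivatives is required separately.\<close>

primrec C_k_on :: "nat \<Rightarrow> (real \<times> real \<Rightarrow> real) \<Rightarrow> (real \<times> real) set \<Rightarrow> bool"
  where
    "C_k_on 0 f U \<longleftrightarrow> continuous_on U f"
  | "C_k_on (Suc k) f U \<longleftrightarrow>
       continuous_on U f \<and>
       (\<forall>(l, r) \<in> U. (\<lambda>x. f (x, r)) field_differentiable at l \<and>
                     (\<lambda>x. f (l, x)) field_differentiable at r) \<and>
       C_k_on k (pd1 f) U \<and> C_k_on k (pd2 f) U"

definition period_doubling_condition :: "(real \<times> real \<Rightarrow> real) \<Rightarrow> real \<Rightarrow> real \<Rightarrow> bool"
  where "period_doubling_condition f l0 r0 \<longleftrightarrow>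
    (\<exists>U. open U \<and> (l0, r0) \<in> U \<and> C_k_on 3 f U) \<and>
    f (l0, r0) = r0 \<and>
    pd2 f (l0, r0) = -1 \<and>
    pd1 (pd2 f) (l0, r0) + 1/2 * pd1 f (l0, r0) * pd2 (pd2 f) (l0, r0) \<noteq> 0 \<and>
    1/2 * (pd2 (pd2 f) (l0, r0))\<^sup>2 + 1/3 * pd2 (pd2 (pd2 f)) (l0, r0) \<noteq> 0"

definition two_periodic_pair :: "(real \<Rightarrow> real) \<Rightarrow> real \<Rightarrow> real \<Rightarrow> bool"
  where "two_periodic_pair h r1 r2 \<longleftrightarrow> r1 \<noteq> r2 \<and> h r1 = r2 \<and> h r2 = r1"

definition Theta :: "(real \<times> real \<Rightarrow> real) \<Rightarrow> real \<Rightarrow> real \<times> S1 \<Rightarrow> S1"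
  where "Theta g l = (\<lambda>(r, t). t + S1_class (g (l, r)))"

definition F_map ::
    "(real \<times> real \<Rightarrow> real) \<Rightarrow> (real \<times> real \<Rightarrow> real) \<Rightarrow> real \<Rightarrow> real \<times> S1 \<Rightarrow> real \<times> S1"
  where "F_map f g l = (\<lambda>(r, t). (f (l, r), Theta g l (r, t)))"

definition is_circle :: "(real \<times> S1) set \<Rightarrow> bool"
  where "is_circle \<Gamma> \<longleftrightarrow> \<Gamma> homeomorphic (UNIV :: S1 set)"

definition invariant_under :: "('a \<Rightarrow> 'a) \<Rightarrow> 'a set \<Rightarrow> bool"
  where "invariant_under h A \<longleftrightarrow> h ` A = A"

end

theory Submission
  imports Defs
begin

text \<open>
  Over a two-periodic orbit \<open>{r\<^sub>1, r\<^sub>2}\<close> of \<open>f(\<lambda>, \<cdot>)\<close> the skew product acts on the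
  fibres by rotations, so the two fibres are circles that it exchanges. The theorem therefore
  reduces to the one-dimensional flip bifurcation: such an orbit exists for all parameters close
  to \<open>\<lambda>\<^sub>0\<close> on one side of it.

  The orbit is found by the intermediate value theorem applied to \<open>f\<^sup>2(\<lambda>, r) - r\<close>. Write
  \<open>c\<close> and \<open>d\<close> for the two quantities that the bifurcation condition requires to be nonzero:
  \<open>d\<close> contains the mixed second derivative and \<open>c\<close> the third derivative in \<open>r\<close>.
  At \<open>\<lambda> = \<lambda>\<^sub>0\<close> one has \<open>f\<^sup>2(\<lambda>\<^sub>0, r\<^sub>0 + s) - (r\<^sub>0 + s) = - c s\<^sup>3 + o(s\<^sup>3)\<close>, so at one fixed
  small \<open>\<delta> > 0\<close> the displacement at \<open>r\<^sub>0 + \<delta>\<close> has the sign of \<open>- c\<close>, and it keeps this sign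
  for all \<open>\<lambda>\<close> close to \<open>\<lambda>\<^sub>0\<close> (lemma \<open>second_iterate_displacement_sign\<close>). For such \<open>\<lambda>\<close> there
  is exactly one fixed point \<open>p\<close> near \<open>r\<^sub>0\<close>, because \<open>f(\<lambda>, r) - r\<close> is strictly decreasing in
  \<open>r\<close>. Its multiplier \<open>m\<close> satisfies \<open>m + 1 \<approx> d (\<lambda> - \<lambda>\<^sub>0)\<close> (lemma \<open>fixed_point_multiplier_sign\<close>),
  and the displacement just to the right of \<open>p\<close> has the sign of \<open>m\<^sup>2 - 1\<close>, which is the sign of
  \<open>- d (\<lambda> - \<lambda>\<^sub>0)\<close>. On the side where \<open>c d (\<lambda> - \<lambda>\<^sub>0) < 0\<close> the two signs are opposite, and the
  displacement has a zero between \<open>p\<close> and \<open>r\<^sub>0 + \<delta>\<close>. This zero is not a fixed point, since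
  \<open>p\<close> is the only one there (lemma \<open>two_periodic_pair_right_of_fixed_point\<close>).
\<close>

section \<open>Fibres over a two-periodic orbit\<close>

lemma is_circle_fibre: "is_circle ({r} \<times> UNIV)"
proof -
  have "homeomorphism ({r} \<times> (UNIV :: S1 set)) UNIV snd (Pair r)"
    by (auto simp: homeomorphism_def intro!: continuous_intros)
  then show ?thesis
    unfolding is_circle_def homeomorphic_def by blast
qed

text \<open>A rotation is onto, so a fibre is mapped onto the whole fibre over the image point.\<close>

lemma F_map_image_fibre: "F_map f g l ` ({r} \<times> UNIV) = {f (l, r)} \<times> UNIV"
proof
  show "{f (l, r)} \<times> UNIV \<subseteq> F_map f g l ` ({r} \<times> UNIV)"
  proof clarify
    fix t :: S1
    have "(f (l, r), t) = F_map f g l (r, t - S1_class (g (l, r)))"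
      by (simp add: F_map_def Theta_def)
    then show "(f (l, r), t) \<in> F_map f g l ` ({r} \<times> UNIV)"
      by blast
  qed
qed (auto simp: F_map_def)

section \<open>Two-periodic points of a map of the line\<close>

text \<open>Near \<open>p\<close> the displacement \<open>u (u r) - r\<close> is approximately \<open>(m\<^sup>2 - 1) (r - p)\<close>. The factor
  \<open>s\<close> carries the sign, so that both directions of the bifurcation are covered at once.\<close>

lemma two_periodic_pair_right_of_fixed_point:
  fixes u :: "real \<Rightarrow> real"
  assumes "p < b" and fixed: "u p = p" and der: "(u has_real_derivative m) (at p)"
    and cont: "continuous_on {p..b} (\<lambda>r. u (u r))"
    and near: "s * (m\<^sup>2 - 1) > 0" and far: "s * (u (u b) - b) < 0"
    and no_fixed: "\<And>r. p < r \<Longrightarrow> r \<le> b \<Longrightarrow> u r \<noteq> r"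
  obtains r where "two_periodic_pair u r (u r)"
proof -
  define h where "h r = s * (u (u r) - r)" for r
  have "((\<lambda>r. u (u r)) has_real_derivative m * m) (at p)"
    using DERIV_chain2[of u m u p m UNIV] der fixed by simp
  then have "(h has_real_derivative s * (m\<^sup>2 - 1)) (at p)"
    unfolding h_def by (auto intro!: derivative_eq_intros simp: power2_eq_square)
  then obtain e where e: "e > 0" "\<And>x. 0 < x \<Longrightarrow> x < e \<Longrightarrow> h p < h (p + x)"
    using DERIV_pos_inc_right near by blast
  define a where "a = p + min (e / 2) ((b - p) / 2)"
  have a: "p < a" "a < b"
    using e(1) \<open>p < b\<close> by (auto simp: a_def min_def field_simps)
  have "h p < h a"
    unfolding a_def using e \<open>p < b\<close> by (intro e(2)) (auto simp: min_def)
  then have "h a \<ge> 0"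
    by (simp add: h_def fixed)
  moreover have "h b < 0"
    using far by (simp add: h_def)
  moreover have "continuous_on {a..b} h"
    unfolding h_def using a
    by (intro continuous_intros continuous_on_subset[OF cont]) auto
  ultimately obtain r where r: "a \<le> r" "r \<le> b" "h r = 0"
    using IVT2'[of h b 0 a] a by auto
  have "u (u r) = r"
    using r(3) near by (auto simp: h_def)
  moreover have "u r \<noteq> r"
    using no_fixed r a by simp
  ultimately show ?thesis
    using that[of r] by (simp add: two_periodic_pair_def)
qed

lemma neg_right_of_zero:
  fixes h h' :: "real \<Rightarrow> real"
  assumes "h a = 0" and der: "\<And>x. a \<le> x \<Longrightarrow> x < b \<Longrightarrow> (h has_real_derivative h' x) (at x)"
    and neg: "\<And>x. a < x \<Longrightarrow> x < b \<Longrightarrow> h' x < 0" and "a < x" "x < b"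
  shows "h x < 0"
proof -
  obtain z where "a < z" "z < x" "h x - h a = (x - a) * h' z"
    using MVT2[of a x h h'] der \<open>a < x\<close> \<open>x < b\<close> by auto
  then show ?thesis
    using neg[of z] assms by (simp add: mult_pos_neg)
qed

text \<open>The displacement of the second iterate vanishes to second order at a fixed point of
  multiplier \<open>-1\<close>: its second derivative there is \<open>u2 - u2 = 0\<close>. Its third derivative is
  \<open>- 2 u3 - 3 u2\<^sup>2\<close>, which is \<open>-6\<close> times the given combination.\<close>

lemma second_iterate_displacement_sign:
  fixes u u1 u2 :: "real \<Rightarrow> real"
  assumes "open S" "a \<in> S"
    and d1: "\<And>x. x \<in> S \<Longrightarrow> (u has_real_derivative u1 x) (at x)"
    and d2: "\<And>x. x \<in> S \<Longrightarrow> (u1 has_real_derivative u2 x) (at x)"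
    and d3: "(u2 has_real_derivative u3) (at a)"
    and fixed: "u a = a" and mult: "u1 a = -1"
    and c: "s * (1/2 * (u2 a)\<^sup>2 + 1/3 * u3) > 0"
  obtains e where "e > 0" "\<And>x. a < x \<Longrightarrow> x < a + e \<Longrightarrow> s * (u (u x) - x) < 0"
proof -
  define h where "h x = s * (u (u x) - x)" for x
  define h1 where "h1 x = s * (u1 (u x) * u1 x - 1)" for x
  define h2 where "h2 x = s * (u2 (u x) * u1 x * u1 x + u1 (u x) * u2 x)" for x
  have "isCont u a"
    using d1 \<open>a \<in> S\<close> DERIV_isCont by blast
  then have "(u \<longlongrightarrow> a) (nhds a)"
    using tendsto_at_iff_tendsto_nhds[of u a] fixed by (simp add: isCont_def)
  then have "eventually (\<lambda>x. u x \<in> S) (nhds a)"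
    using \<open>open S\<close> \<open>a \<in> S\<close> by (rule topological_tendstoD)
  moreover have "eventually (\<lambda>x. x \<in> S) (nhds a)"
    using \<open>open S\<close> \<open>a \<in> S\<close> by (rule eventually_nhds_in_open)
  ultimately have "eventually (\<lambda>x. x \<in> S \<and> u x \<in> S) (nhds a)"
    by eventually_elim simp
  then obtain e1 where e1: "e1 > 0" "\<And>x. dist x a < e1 \<Longrightarrow> x \<in> S \<and> u x \<in> S"
    unfolding eventually_nhds_metric by blast
  have S: "x \<in> S" "u x \<in> S" if "a \<le> x" "x < a + e1" for x
    using e1(2)[of x] that by (auto simp: dist_real_def)
  have h: "(h has_real_derivative h1 x) (at x)" if "a \<le> x" "x < a + e1" for x
    unfolding h_def h1_def using S[OF that]
    by (auto intro!: derivative_eq_intros DERIV_chain2[OF d1 d1])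
  have h1: "(h1 has_real_derivative h2 x) (at x)" if "a \<le> x" "x < a + e1" for x
    unfolding h1_def h2_def using S[OF that]
    by (auto intro!: derivative_eq_intros DERIV_chain2[OF d2 d1] d2)
  have "((\<lambda>x. u2 (u x)) has_real_derivative u3 * -1) (at a)"
    "((\<lambda>x. u1 (u x)) has_real_derivative u2 a * -1) (at a)"
    using DERIV_chain2[of u2 u3 u a "-1" UNIV] DERIV_chain2[of u1 "u2 a" u a "-1" UNIV]
      d1[OF \<open>a \<in> S\<close>] d2[OF \<open>a \<in> S\<close>] d3 fixed mult by simp_all
  note this[derivative_intros]
  have "(h2 has_real_derivative - 6 * (s * (1/2 * (u2 a)\<^sup>2 + 1/3 * u3))) (at a)"
    unfolding h2_def using d2[OF \<open>a \<in> S\<close>] d3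
    by (auto intro!: derivative_eq_intros simp: fixed mult power2_eq_square algebra_simps)
  moreover have "- 6 * (s * (1/2 * (u2 a)\<^sup>2 + 1/3 * u3)) < 0"
    using c by linarith
  ultimately obtain e2 where e2: "e2 > 0" "\<And>x. 0 < x \<Longrightarrow> x < e2 \<Longrightarrow> h2 (a + x) < h2 a"
    using DERIV_neg_dec_right by blast
  define e where "e = min e1 e2"
  have h2_neg: "h2 x < 0" if "a < x" "x < a + e" for x
    using e2(2)[of "x - a"] that by (simp add: e_def h2_def fixed mult)
  have zero: "h a = 0" "h1 a = 0"
    by (simp_all add: h_def h1_def fixed mult)
  have h1_neg: "h1 x < 0" if "a < x" "x < a + e" for x
    by (rule neg_right_of_zero[OF zero(2) h1 h2_neg that]) (auto simp: e_def)
  have "h x < 0" if "a < x" "x < a + e" for x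
    by (rule neg_right_of_zero[OF zero(1) h h1_neg that]) (auto simp: e_def)
  then show ?thesis
    using that[of e] e1(1) e2(1) by (simp add: e_def h_def)
qed

section \<open>Calculus of two variables\<close>

lemma open_contains_rectangle:
  assumes "open U" "(a, b) \<in> U"
  obtains A B where "open A" "a \<in> A" "open B" "b \<in> B" "A \<times> B \<subseteq> U"
  using open_prod_elim[OF assms] by (metis mem_Sigma_iff)

lemma open_contains_square:
  fixes U :: "(real \<times> real) set"
  assumes "open U" "(a, b) \<in> U"
  obtains e where "e > 0" "{a - e<..<a + e} \<times> {b - e<..<b + e} \<subseteq> U"
proof -
  obtain A B where AB: "open A" "a \<in> A" "open B" "b \<in> B" "A \<times> B \<subseteq> U"
    using open_contains_rectangle[OF assms] by blast
  obtain e1 where e1: "e1 > 0" "ball a e1 \<subseteq> A"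
    using AB openE by blast
  obtain e2 where e2: "e2 > 0" "ball b e2 \<subseteq> B"
    using AB openE by blast
  have "{a - min e1 e2<..<a + min e1 e2} \<times> {b - min e1 e2<..<b + min e1 e2}
      \<subseteq> ball a e1 \<times> ball b e2"
    by (auto simp: dist_real_def)
  then show ?thesis
    using that[of "min e1 e2"] e1 e2 AB(5) by (meson Sigma_mono min_less_iff_conj order_trans)
qed

lemma MVT_on_convex:
  fixes u u' :: "real \<Rightarrow> real"
  assumes "convex S" "x \<in> S" "y \<in> S"
    and der: "\<And>z. z \<in> S \<Longrightarrow> (u has_real_derivative u' z) (at z)"
  obtains z where "z \<in> S" "u y - u x = (y - x) * u' z"
proof -
  have *: "\<exists>z\<in>S. u b - u a = (b - a) * u' z" if "a < b" "a \<in> S" "b \<in> S" for a b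
  proof -
    have sub: "z \<in> S" if "a \<le> z" "z \<le> b" for z
      using \<open>convex S\<close> \<open>a \<in> S\<close> \<open>b \<in> S\<close> that
      by (meson is_interval_1 is_interval_convex_1)
    obtain z where "a < z" "z < b" "u b - u a = (b - a) * u' z"
      using MVT2[of a b u u'] \<open>a < b\<close> der sub by auto
    then show ?thesis
      using sub[of z] by auto
  qed
  consider "x < y" | "x = y" | "y < x"
    by linarith
  then show ?thesis
  proof cases
    case 1
    then show ?thesis
      using * that assms by blast
  next
    case 2
    then show ?thesis
      using that[of x] assms by simp
  next
    case 3
    then obtain z where "z \<in> S" "u x - u y = (x - y) * u' z"
      using * assms by blast
    then show ?thesis
      using that[of z] by (simp add: algebra_simps)
  qed
qed

lemma C_k_on_SucD:
  assumes "C_k_on (Suc k) f U"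
  shows "C_k_on k f U"
  using assms
proof (induction k arbitrary: f)
  case 0
  then show ?case
    by simp
next
  case (Suc k)
  note C = iffD1[OF C_k_on.simps(2) Suc.prems]
  then have "C_k_on k (pd1 f) U" "C_k_on k (pd2 f) U"
    using Suc.IH by blast+
  then show ?case
    using C unfolding C_k_on.simps(2)[of k] by blast
qed

lemma C_k_on_continuous_on: "C_k_on k f U \<Longrightarrow> continuous_on U f"
  by (cases k) auto

lemma C_k_on_has_derivative_pd1:
  assumes "C_k_on (Suc k) f U" "(l, r) \<in> U"
  shows "((\<lambda>x. f (x, r)) has_real_derivative pd1 f (l, r)) (at l)"
  using assms by (auto simp: pd1_def DERIV_deriv_iff_field_differentiable)

lemma C_k_on_has_derivative_pd2:
  assumes "C_k_on (Suc k) f U" "(l, r) \<in> U"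
  shows "((\<lambda>x. f (l, x)) has_real_derivative pd2 f (l, r)) (at r)"
  using assms by (auto simp: pd2_def DERIV_deriv_iff_field_differentiable)

text \<open>Going from the base point to a fixed point \<open>(l, p)\<close> first in the second and then in the
  first variable, the mean value theorem gives
  \<open>(1 - f\<^sub>r) (p - b) = f\<^sub>l (l - a)\<close> and \<open>f\<^sub>r(l, p) + 1 = f\<^sub>r\<^sub>l (l - a) + f\<^sub>r\<^sub>r (p - b)\<close>, each derivative
  on the right or in the factor \<open>1 - f\<^sub>r\<close> being taken at some nearby point. Eliminating \<open>p - b\<close>
  leaves \<open>(1 - f\<^sub>r) (f\<^sub>r(l, p) + 1) = ((1 - f\<^sub>r) f\<^sub>r\<^sub>l + f\<^sub>r\<^sub>r f\<^sub>l) (l - a)\<close>, where the first factors of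
  the two sides are close to \<open>2\<close> and to \<open>2 d\<close>.\<close>

lemma fixed_point_multiplier_sign:
  fixes f :: "real \<times> real \<Rightarrow> real"
  assumes "open U" "(a, b) \<in> U" and C2: "C_k_on 2 f U"
    and fixed: "f (a, b) = b" and mult: "pd2 f (a, b) = -1"
    and d: "d = pd1 (pd2 f) (a, b) + 1/2 * pd1 f (a, b) * pd2 (pd2 f) (a, b)" "d \<noteq> 0"
  obtains e where "e > 0"
    "\<And>l p. l \<in> {a - e<..<a + e} \<Longrightarrow> p \<in> {b - e<..<b + e} \<Longrightarrow> l \<noteq> a \<Longrightarrow> f (l, p) = p \<Longrightarrow>
      (pd2 f (l, p) + 1) * (d * (l - a)) > 0"
proof -
  have C: "C_k_on (Suc 1) f U" "C_k_on (Suc 0) (pd1 f) U" "C_k_on (Suc 0) (pd2 f) U"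
    using C2 by (auto simp: numeral_2_eq_2)
  have cont: "continuous_on U (pd1 f)" "continuous_on U (pd2 f)"
    "continuous_on U (pd1 (pd2 f))" "continuous_on U (pd2 (pd2 f))"
    using C by auto
  (* The four derivatives are taken at different points, so their combination is made a
     function of four points, and a neighbourhood is chosen where it is positive. *)
  define x0 where "x0 = (a, b)"
  define G where "G = (\<lambda>(x1, x2, x3, x4).
    d * ((1 - pd2 f x1) * pd1 (pd2 f) x2 + pd2 (pd2 f) x3 * pd1 f x4))"
  define D where "D = U \<times> U \<times> U \<times> U"
  have "open D"
    unfolding D_def using \<open>open U\<close> by (intro open_Times)
  have "continuous_on D G"
    unfolding G_def D_def case_prod_unfold
    by (intro continuous_intros continuous_on_compose2[OF cont(1)]
        continuous_on_compose2[OF cont(2)] continuous_on_compose2[OF cont(3)]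
        continuous_on_compose2[OF cont(4)]) auto
  then have "open (D \<inter> G -` {0<..})"
    using \<open>open D\<close> by (intro continuous_open_preimage) auto
  moreover have "G (x0, x0, x0, x0) = 2 * d\<^sup>2"
  proof -
    have "(1 - pd2 f x0) * pd1 (pd2 f) x0 + pd2 (pd2 f) x0 * pd1 f x0 = 2 * d"
      using mult by (simp add: d(1) x0_def)
    then show ?thesis
      by (simp add: G_def power2_eq_square)
  qed
  then have "(x0, x0, x0, x0) \<in> D \<inter> G -` {0<..}"
    using \<open>(a, b) \<in> U\<close> \<open>d \<noteq> 0\<close> by (simp add: D_def x0_def)
  ultimately obtain A1 B1 where 1: "open A1" "x0 \<in> A1" "open B1" "(x0, x0, x0) \<in> B1"
      "A1 \<times> B1 \<subseteq> D \<inter> G -` {0<..}"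
    by (rule open_contains_rectangle)
  obtain A2 B2 where 2: "open A2" "x0 \<in> A2" "open B2" "(x0, x0) \<in> B2" "A2 \<times> B2 \<subseteq> B1"
    using open_contains_rectangle[OF 1(3,4)] by blast
  obtain A3 A4 where 3: "open A3" "x0 \<in> A3" "open A4" "x0 \<in> A4" "A3 \<times> A4 \<subseteq> B2"
    using open_contains_rectangle[OF 2(3,4)] by blast
  have "open (U \<inter> pd2 f -` {..<0})"
    using \<open>open U\<close> cont(2) by (intro continuous_open_preimage) auto
  then have "open (A1 \<inter> A2 \<inter> A3 \<inter> A4 \<inter> (U \<inter> pd2 f -` {..<0}))"
    using 1 2 3 by (simp add: open_Int)
  moreover have "(a, b) \<in> A1 \<inter> A2 \<inter> A3 \<inter> A4 \<inter> (U \<inter> pd2 f -` {..<0})"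
    using 1 2 3 mult \<open>(a, b) \<in> U\<close> by (simp add: x0_def)
  ultimately obtain e where e: "e > 0"
      "{a - e<..<a + e} \<times> {b - e<..<b + e} \<subseteq> A1 \<inter> A2 \<inter> A3 \<inter> A4 \<inter> (U \<inter> pd2 f -` {..<0})"
    by (rule open_contains_square)
  define I J where "I = {a - e<..<a + e}" and "J = {b - e<..<b + e}"
  note e(2)[folded I_def J_def]
  then have sub: "I \<times> J \<subseteq> A1" "I \<times> J \<subseteq> A2" "I \<times> J \<subseteq> A3" "I \<times> J \<subseteq> A4"
      "I \<times> J \<subseteq> U \<inter> pd2 f -` {..<0}"
    by (simp_all only: Int_subset_iff)
  have IJ: "(l, r) \<in> U" "pd2 f (l, r) < 0" if "l \<in> I" "r \<in> J" for l r
    using sub(5) that by auto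
  have Gpos: "G (x1, x2, x3, x4) > 0"
    if "x1 \<in> I \<times> J" "x2 \<in> I \<times> J" "x3 \<in> I \<times> J" "x4 \<in> I \<times> J" for x1 x2 x3 x4
  proof -
    have "(x3, x4) \<in> B2"
      using 3(5) sub(3,4) that(3,4) by blast
    then have "(x2, x3, x4) \<in> B1"
      using 2(5) sub(2) that(2) by blast
    then have "(x1, x2, x3, x4) \<in> D \<inter> G -` {0<..}"
      using 1(5) sub(1) that(1) by blast
    then show ?thesis
      by simp
  qed
  have cvx: "convex I" "convex J" and ab: "a \<in> I" "b \<in> J"
    using e(1) by (auto simp: I_def J_def)
  show ?thesis
  proof (rule that[OF e(1)], fold I_def J_def)
    fix l p assume l: "l \<in> I" and p: "p \<in> J" and "l \<noteq> a" and fp: "f (l, p) = p"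
    obtain w where w: "w \<in> I" "f (l, p) - f (a, p) = (l - a) * pd1 f (w, p)"
      using MVT_on_convex[OF cvx(1) ab(1) l, of "\<lambda>x. f (x, p)" "\<lambda>x. pd1 f (x, p)"]
        C_k_on_has_derivative_pd1[OF C(1)] IJ(1)[OF _ p] by metis
    obtain x where x: "x \<in> J" "f (a, p) - f (a, b) = (p - b) * pd2 f (a, x)"
      using MVT_on_convex[OF cvx(2) ab(2) p, of "\<lambda>x. f (a, x)" "\<lambda>x. pd2 f (a, x)"]
        C_k_on_has_derivative_pd2[OF C(1)] IJ(1)[OF ab(1)] by metis
    obtain y where y: "y \<in> I" "pd2 f (l, p) - pd2 f (a, p) = (l - a) * pd1 (pd2 f) (y, p)"
      using MVT_on_convex[OF cvx(1) ab(1) l, of "\<lambda>x. pd2 f (x, p)" "\<lambda>x. pd1 (pd2 f) (x, p)"]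
        C_k_on_has_derivative_pd1[OF C(3)] IJ(1)[OF _ p] by metis
    obtain z where z: "z \<in> J" "pd2 f (a, p) - pd2 f (a, b) = (p - b) * pd2 (pd2 f) (a, z)"
      using MVT_on_convex[OF cvx(2) ab(2) p, of "\<lambda>x. pd2 f (a, x)" "\<lambda>x. pd2 (pd2 f) (a, x)"]
        C_k_on_has_derivative_pd2[OF C(3)] IJ(1)[OF ab(1)] by metis
    define K where "K = 1 - pd2 f (a, x)"
    have "K > 0"
      using IJ(2)[OF ab(1) x(1)] by (simp add: K_def)
    have pb: "K * (p - b) = (l - a) * pd1 f (w, p)"
      using w(2) x(2) fp fixed by (simp add: K_def algebra_simps)
    have m: "pd2 f (l, p) + 1 = (l - a) * pd1 (pd2 f) (y, p) + (p - b) * pd2 (pd2 f) (a, z)"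
      using y(2) z(2) mult by simp
    have "K * (pd2 f (l, p) + 1)
        = K * ((l - a) * pd1 (pd2 f) (y, p)) + (K * (p - b)) * pd2 (pd2 f) (a, z)"
      unfolding m by (simp add: algebra_simps)
    also have "\<dots> = (l - a) * (K * pd1 (pd2 f) (y, p) + pd2 (pd2 f) (a, z) * pd1 f (w, p))"
      unfolding pb by (simp add: algebra_simps)
    finally have "(K * (pd2 f (l, p) + 1)) * (d * (l - a))
        = (l - a)\<^sup>2 * G ((a, x), (y, p), (a, z), (w, p))"
      by (simp add: G_def K_def[symmetric] power2_eq_square)
    also have "\<dots> > 0"
      using Gpos l p ab w x y z \<open>l \<noteq> a\<close> by simp
    finally show "(pd2 f (l, p) + 1) * (d * (l - a)) > 0"
      using \<open>K > 0\<close> by (simp add: mult.assoc zero_less_mult_iff)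
  qed
qed

section \<open>The flip bifurcation\<close>

text \<open>The sign of \<open>s\<close>, which is \<open>c d\<close> in the notation above, decides on which side of \<open>l0\<close> the
  orbits are.\<close>

lemma period_doubling_two_periodic_orbits:
  assumes "period_doubling_condition f l0 r0"
  obtains s e where "s \<noteq> 0" "e > 0"
    "\<And>l. \<bar>l - l0\<bar> < e \<Longrightarrow> s * (l - l0) < 0 \<Longrightarrow>
      \<exists>r1 r2. two_periodic_pair (\<lambda>r. f (l, r)) r1 r2"
proof -
  obtain U where U: "open U" "(l0, r0) \<in> U" and C3: "C_k_on 3 f U"
    and fixed: "f (l0, r0) = r0" and mult: "pd2 f (l0, r0) = -1"
    using assms by (auto simp: period_doubling_condition_def)
  define d where "d = pd1 (pd2 f) (l0, r0) + 1/2 * pd1 f (l0, r0) * pd2 (pd2 f) (l0, r0)"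
  define c where "c = 1/2 * (pd2 (pd2 f) (l0, r0))\<^sup>2 + 1/3 * pd2 (pd2 (pd2 f)) (l0, r0)"
  have "d \<noteq> 0" "c \<noteq> 0"
    using assms by (auto simp: period_doubling_condition_def d_def c_def)
  have C: "C_k_on (Suc 2) f U" "C_k_on (Suc 1) (pd2 f) U" "C_k_on (Suc 0) (pd2 (pd2 f)) U"
    using C3 by (auto simp: numeral_3_eq_3 numeral_2_eq_2)
  have cont: "continuous_on U f" "continuous_on U (pd2 f)"
    using C C_k_on_continuous_on by blast+
  obtain e1 where e1: "e1 > 0"
    "\<And>l p. l \<in> {l0 - e1<..<l0 + e1} \<Longrightarrow> p \<in> {r0 - e1<..<r0 + e1} \<Longrightarrow> l \<noteq> l0 \<Longrightarrow>
      f (l, p) = p \<Longrightarrow> (pd2 f (l, p) + 1) * (d * (l - l0)) > 0"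
    using fixed_point_multiplier_sign[OF U C_k_on_SucD[OF C(1)] fixed mult d_def \<open>d \<noteq> 0\<close>]
    by blast

  (* On V the maps f(l, _) decrease. As f is regular only near the base point, the second
     iterates can be controlled only where the first image stays in V; this is W. *)
  define V where "V = U \<inter> pd2 f -` {..<0}"
  have "open V"
    unfolding V_def using U(1) cont(2) by (intro continuous_open_preimage) auto
  have "V \<subseteq> U"
    by (auto simp: V_def)
  have contV: "continuous_on V f"
    using cont(1) \<open>V \<subseteq> U\<close> continuous_on_subset by blast
  define W where "W = V \<inter> (\<lambda>x. (fst x, f x)) -` V"
  have "open W"
    unfolding W_def using \<open>open V\<close> contV by (intro continuous_open_preimage continuous_intros)
  moreover have "(l0, r0) \<in> W"
    using U(2) mult fixed by (simp add: W_def V_def)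
  ultimately obtain e2 where e2: "e2 > 0" "{l0 - e2<..<l0 + e2} \<times> {r0 - e2<..<r0 + e2} \<subseteq> W"
    by (rule open_contains_square)
  define e where "e = min e1 e2"
  have "e > 0" "e \<le> e1" "e \<le> e2"
    using e1(1) e2(1) by (auto simp: e_def)
  define I J where "I = {l0 - e<..<l0 + e}" and "J = {r0 - e<..<r0 + e}"
  have "I \<times> J \<subseteq> {l0 - e2<..<l0 + e2} \<times> {r0 - e2<..<r0 + e2}"
    using \<open>e \<le> e2\<close> by (auto simp: I_def J_def)
  then have "I \<times> J \<subseteq> W"
    using e2(2) by (rule order_trans)
  then have IJ: "(l, r) \<in> U" "pd2 f (l, r) < 0" "(l, r) \<in> V" "(l, f (l, r)) \<in> V"
    if "l \<in> I" "r \<in> J" for l r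
    using that by (auto simp: W_def V_def)
  have "l0 \<in> I" "r0 \<in> J" "convex J" "open I" "open J"
    using \<open>e > 0\<close> by (auto simp: I_def J_def)

  have decr: "f (l, y) - y < f (l, x) - x" 
    if "l \<in> I" and xy: "x \<in> J" "y \<in> J" "x < y" for l x y
  proof -
    obtain z where z: "z \<in> J" "f (l, y) - f (l, x) = (y - x) * pd2 f (l, z)"
      using MVT_on_convex[OF \<open>convex J\<close> xy(1,2), of "\<lambda>r. f (l, r)" "\<lambda>r. pd2 f (l, r)"]
        C_k_on_has_derivative_pd2[OF C(1)] IJ(1)[OF \<open>l \<in> I\<close>] by metis
    then have "f (l, y) - f (l, x) < 0"
      using IJ(2)[OF \<open>l \<in> I\<close> z(1)] \<open>x < y\<close> by (simp add: mult_pos_neg)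
    then show ?thesis
      using \<open>x < y\<close> by simp
  qed

  have "c * c > 0"
    using \<open>c \<noteq> 0\<close> not_real_square_gt_zero by blast
  then have c_sq: "c * (1/2 * (pd2 (pd2 f) (l0, r0))\<^sup>2 + 1/3 * pd2 (pd2 (pd2 f)) (l0, r0)) > 0"
    by (simp add: c_def)
  obtain e3 where e3: "e3 > 0"
    "\<And>x. r0 < x \<Longrightarrow> x < r0 + e3 \<Longrightarrow> c * (f (l0, f (l0, x)) - x) < 0"
  proof (rule second_iterate_displacement_sign[of J r0 "\<lambda>r. f (l0, r)" "\<lambda>r. pd2 f (l0, r)"
        "\<lambda>r. pd2 (pd2 f) (l0, r)" "pd2 (pd2 (pd2 f)) (l0, r0)" c, OF _ _ _ _ _ _ _ c_sq])
    show "((\<lambda>r. f (l0, r)) has_real_derivative pd2 f (l0, x)) (at x)"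
      "((\<lambda>r. pd2 f (l0, r)) has_real_derivative pd2 (pd2 f) (l0, x)) (at x)" if "x \<in> J" for x
      using C_k_on_has_derivative_pd2[OF C(1)] C_k_on_has_derivative_pd2[OF C(2)]
        IJ(1)[OF \<open>l0 \<in> I\<close> that] by blast+
    show "((\<lambda>r. pd2 (pd2 f) (l0, r)) has_real_derivative pd2 (pd2 (pd2 f)) (l0, r0)) (at r0)"
      using C_k_on_has_derivative_pd2[OF C(3)] U(2) by blast
  qed (use \<open>open J\<close> \<open>r0 \<in> J\<close> fixed mult in auto)
  define q where "q = min e e3 / 2"
  have q: "0 < q" "q < e" "q < e3"
    using \<open>e > 0\<close> e3(1) by (auto simp: q_def min_def)
  have qJ: "r0 + q \<in> J" "r0 - q \<in> J"
    using q by (auto simp: J_def)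

  (* The inequalities that bracket the fixed point and the sign of the displacement at r0 + q
     are open conditions on l that hold at l0. *)
  have cont_fst: "continuous_on I (\<lambda>l. f (l, r))" if "r \<in> J" for r
    using that by (intro continuous_on_compose2[OF contV] continuous_intros) (auto simp: IJ)
  have "continuous_on I (\<lambda>l. f (l, f (l, r0 + q)))"
    using qJ by (intro continuous_on_compose2[OF contV] continuous_intros cont_fst)
      (auto simp: IJ)
  then have cont_I: "continuous_on I (\<lambda>l. c * (f (l, f (l, r0 + q)) - (r0 + q)))"
    "continuous_on I (\<lambda>l. f (l, r0 + q) - (r0 + q))"
    "continuous_on I (\<lambda>l. f (l, r0 - q) - (r0 - q))"
    by (intro continuous_intros cont_fst qJ; assumption?)+
  define N where "N = (I \<inter> (\<lambda>l. c * (f (l, f (l, r0 + q)) - (r0 + q))) -` {..<0})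
    \<inter> (I \<inter> (\<lambda>l. f (l, r0 + q) - (r0 + q)) -` {..<0})
    \<inter> (I \<inter> (\<lambda>l. f (l, r0 - q) - (r0 - q)) -` {0<..})"
  have "open N"
    unfolding N_def by (intro open_Int continuous_open_preimage[OF _ \<open>open I\<close>] cont_I) auto
  moreover have "l0 \<in> N"
    using e3(2)[of "r0 + q"] decr[OF \<open>l0 \<in> I\<close> \<open>r0 \<in> J\<close> qJ(1)] decr[OF \<open>l0 \<in> I\<close> qJ(2) \<open>r0 \<in> J\<close>]
      q fixed \<open>l0 \<in> I\<close> by (simp add: N_def)
  ultimately obtain e4 where e4: "e4 > 0" "\<And>l. dist l l0 < e4 \<Longrightarrow> l \<in> N"
    unfolding open_dist by blast

  show ?thesis
  proof (rule that[of "c * d" e4])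
    show "c * d \<noteq> 0" "e4 > 0"
      using \<open>c \<noteq> 0\<close> \<open>d \<noteq> 0\<close> e4(1) by auto
    fix l assume "\<bar>l - l0\<bar> < e4" and side: "c * d * (l - l0) < 0"
    then have l: "l \<in> I" "f (l, r0 - q) - (r0 - q) > 0" "f (l, r0 + q) - (r0 + q) < 0"
      and far: "c * (f (l, f (l, r0 + q)) - (r0 + q)) < 0"
      using e4(2)[of l] by (auto simp: dist_real_def N_def)
    have contJ: "continuous_on J (\<lambda>r. f (l, r))"
      using l(1) by (intro continuous_on_compose2[OF contV] continuous_intros) (auto simp: IJ)
    have sub: "{r0 - q..r0 + q} \<subseteq> J"
      using q by (auto simp: J_def)
    have "continuous_on {r0 - q..r0 + q} (\<lambda>r. f (l, r) - r)"
      by (intro continuous_intros continuous_on_subset[OF contJ sub])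
    then obtain p where p: "r0 - q \<le> p" "p \<le> r0 + q" "f (l, p) - p = 0"
      using IVT2'[of "\<lambda>r. f (l, r) - r" "r0 + q" 0 "r0 - q"] l q by auto
    have "p \<noteq> r0 + q"
      using p(3) l(3) by auto
    then have "p < r0 + q"
      using p(2) by simp
    have "p \<in> J"
      using p sub by auto
    have fp: "f (l, p) = p"
      using p(3) by simp
    define m where "m = pd2 f (l, p)"
    have "m < 0"
      using IJ(2)[OF l(1) \<open>p \<in> J\<close>] by (simp add: m_def)
    have "l \<noteq> l0"
      using side by auto
    then have "(m + 1) * (d * (l - l0)) > 0"
      unfolding m_def using l(1) \<open>p \<in> J\<close> \<open>e \<le> e1\<close> fp by (intro e1(2)) (auto simp: I_def J_def)
    moreover have "(m - 1) * (c * d * (l - l0)) > 0"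
      using side \<open>m < 0\<close> by (intro mult_neg_neg) auto
    ultimately have "((m + 1) * (d * (l - l0))) * ((m - 1) * (c * d * (l - l0))) > 0"
      by (rule mult_pos_pos)
    then have "(c * (m\<^sup>2 - 1)) * (d * (l - l0))\<^sup>2 > 0"
      by (simp add: power2_eq_square algebra_simps)
    then have near: "c * (m\<^sup>2 - 1) > 0"
      using zero_le_power2[of "d * (l - l0)"] by (metis mult_nonpos_nonneg not_less)
    have sub': "{p..r0 + q} \<subseteq> J"
      using sub p(1) by auto
    have "continuous_on {p..r0 + q} (\<lambda>r. f (l, f (l, r)))"
      using sub' l(1)
      by (intro continuous_on_compose2[OF contV] continuous_intros
          continuous_on_subset[OF contJ]) (auto intro!: IJ)
    moreover have "f (l, r) \<noteq> r" if "p < r" "r \<le> r0 + q" for r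
    proof -
      have "r \<in> J"
        using that sub' by auto
      from decr[OF l(1) \<open>p \<in> J\<close> this \<open>p < r\<close>] show ?thesis
        using fp by simp
    qed
    moreover have "((\<lambda>r. f (l, r)) has_real_derivative m) (at p)"
      unfolding m_def by (rule C_k_on_has_derivative_pd2[OF C(1) IJ(1)[OF l(1) \<open>p \<in> J\<close>]])
    ultimately show "\<exists>r1 r2. two_periodic_pair (\<lambda>r. f (l, r)) r1 r2"
      using two_periodic_pair_right_of_fixed_point[of p "r0 + q" "\<lambda>r. f (l, r)" m c]
        \<open>p < r0 + q\<close> fp near far by blast
  qed
qed

theorem theorem2:
  fixes f g :: "real \<times> real \<Rightarrow> real" and lam\<^sub>0 r\<^sub>0 :: real
  assumes "period_doubling_condition f lam\<^sub>0 r\<^sub>0"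
    and "\<And>lam. continuous_on UNIV (\<lambda>r. g (lam, r))"
    and "\<And>lam r\<^sub>1 r\<^sub>2. two_periodic_pair (\<lambda>r. f (lam, r)) r\<^sub>1 r\<^sub>2 \<Longrightarrow>
           g (lam, r\<^sub>1) \<notin> \<rat> \<and> g (lam, r\<^sub>2) \<notin> \<rat>"
  shows "\<exists>lam\<^sub>1. lam\<^sub>1 \<noteq> lam\<^sub>0 \<and>
    (\<forall>lam. (lam\<^sub>0 < lam \<and> lam < lam\<^sub>1) \<or> (lam\<^sub>1 < lam \<and> lam < lam\<^sub>0) \<longrightarrow>
      (\<exists>\<Gamma>\<^sub>1 \<Gamma>\<^sub>2 :: (real \<times> S1) set.
        is_circle \<Gamma>\<^sub>1 \<and> is_circle \<Gamma>\<^sub>2 \<and>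
        invariant_under (F_map f g lam \<circ> F_map f g lam) \<Gamma>\<^sub>1 \<and>
        invariant_under (F_map f g lam \<circ> F_map f g lam) \<Gamma>\<^sub>2 \<and>
        (\<Gamma>\<^sub>1 \<inter> \<Gamma>\<^sub>2 = {} \<and>
         (F_map f g lam \<circ> F_map f g lam) ` \<Gamma>\<^sub>1 = \<Gamma>\<^sub>1 \<and>
         (F_map f g lam \<circ> F_map f g lam) ` \<Gamma>\<^sub>2 = \<Gamma>\<^sub>2) \<and>
        (F_map f g lam ` \<Gamma>\<^sub>1 = \<Gamma>\<^sub>2 \<and> F_map f g lam ` \<Gamma>\<^sub>2 = \<Gamma>\<^sub>1) \<and>
        F_map f g lam ` (\<Gamma>\<^sub>1 \<union> \<Gamma>\<^sub>2) = \<Gamma>\<^sub>1 \<union> \<Gamma>\<^sub>2))"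
proof -
  obtain s e where s: "s \<noteq> 0" "e > 0"
    and orbit: "\<And>l. \<bar>l - lam\<^sub>0\<bar> < e \<Longrightarrow> s * (l - lam\<^sub>0) < 0 \<Longrightarrow>
      \<exists>r1 r2. two_periodic_pair (\<lambda>r. f (l, r)) r1 r2"
    using period_doubling_two_periodic_orbits[OF assms(1)] by blast
  define lam\<^sub>1 where "lam\<^sub>1 = lam\<^sub>0 - sgn s * e"
  show ?thesis
  proof (rule exI[of _ lam\<^sub>1], intro conjI allI impI)
    show "lam\<^sub>1 \<noteq> lam\<^sub>0"
      using s by (simp add: lam\<^sub>1_def sgn_if)
    fix lam assume "(lam\<^sub>0 < lam \<and> lam < lam\<^sub>1) \<or> (lam\<^sub>1 < lam \<and> lam < lam\<^sub>0)"
    then have "\<bar>lam - lam\<^sub>0\<bar> < e" "s * (lam - lam\<^sub>0) < 0"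
      using s by (auto simp: lam\<^sub>1_def sgn_if mult_less_0_iff split: if_splits)
    then obtain r1 r2 where pair: "two_periodic_pair (\<lambda>r. f (lam, r)) r1 r2"
      using orbit by blast
    define \<Gamma>\<^sub>1 \<Gamma>\<^sub>2 :: "(real \<times> S1) set" where "\<Gamma>\<^sub>1 = {r1} \<times> UNIV" and "\<Gamma>\<^sub>2 = {r2} \<times> UNIV"
    have "is_circle \<Gamma>\<^sub>1" "is_circle \<Gamma>\<^sub>2"
      by (simp_all add: \<Gamma>\<^sub>1_def \<Gamma>\<^sub>2_def is_circle_fibre)
    have "\<Gamma>\<^sub>1 \<inter> \<Gamma>\<^sub>2 = {}"
      using pair by (auto simp: \<Gamma>\<^sub>1_def \<Gamma>\<^sub>2_def two_periodic_pair_def)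
    have image: "F_map f g lam ` \<Gamma>\<^sub>1 = \<Gamma>\<^sub>2" "F_map f g lam ` \<Gamma>\<^sub>2 = \<Gamma>\<^sub>1"
      using pair by (simp_all add: \<Gamma>\<^sub>1_def \<Gamma>\<^sub>2_def F_map_image_fibre two_periodic_pair_def)
    have "(F_map f g lam \<circ> F_map f g lam) ` \<Gamma>\<^sub>1 = \<Gamma>\<^sub>1"
      "(F_map f g lam \<circ> F_map f g lam) ` \<Gamma>\<^sub>2 = \<Gamma>\<^sub>2"
      unfolding image_comp[symmetric] image by (rule refl)+
    moreover have "F_map f g lam ` (\<Gamma>\<^sub>1 \<union> \<Gamma>\<^sub>2) = \<Gamma>\<^sub>1 \<union> \<Gamma>\<^sub>2"
      unfolding image_Un image by (rule Un_commute)
    ultimately show "\<exists>\<Gamma>\<^sub>1 \<Gamma>\<^sub>2 :: (real \<times> S1) set.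
        is_circle \<Gamma>\<^sub>1 \<and> is_circle \<Gamma>\<^sub>2 \<and>
        invariant_under (F_map f g lam \<circ> F_map f g lam) \<Gamma>\<^sub>1 \<and>
        invariant_under (F_map f g lam \<circ> F_map f g lam) \<Gamma>\<^sub>2 \<and>
        (\<Gamma>\<^sub>1 \<inter> \<Gamma>\<^sub>2 = {} \<and>
         (F_map f g lam \<circ> F_map f g lam) ` \<Gamma>\<^sub>1 = \<Gamma>\<^sub>1 \<and>
         (F_map f g lam \<circ> F_map f g lam) ` \<Gamma>\<^sub>2 = \<Gamma>\<^sub>2) \<and>
        (F_map f g lam ` \<Gamma>\<^sub>1 = \<Gamma>\<^sub>2 \<and> F_map f g lam ` \<Gamma>\<^sub>2 = \<Gamma>\<^sub>1) \<and>
        F_map f g lam ` (\<Gamma>\<^sub>1 \<union> \<Gamma>\<^sub>2) = \<Gamma>\<^sub>1 \<union> \<Gamma>\<^sub>2"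
      unfolding invariant_under_def
      using \<open>is_circle \<Gamma>\<^sub>1\<close> \<open>is_circle \<Gamma>\<^sub>2\<close> \<open>\<Gamma>\<^sub>1 \<inter> \<Gamma>\<^sub>2 = {}\<close> image
      by - (rule exI[of _ \<Gamma>\<^sub>1], rule exI[of _ \<Gamma>\<^sub>2], intro conjI)
  qed
qed

end
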